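(* Let $\mathbb{F}$ be any field. There are at least as many pairwise nonisomorphic simple Hom-Lie structures on $\mathfrak{aff}(\mathbb{F})$ as elements in $\mathbb{F}$; that is, the cardinality of the set of isomorphism classes of simple Hom-Lie algebras of the form $(\mathfrak{aff}(\mathbb{F}),[\cdot,\cdot],\sigma)$, where $\sigma$ runs over twisting maps of $\mathfrak{aff}(\mathbb{F})$, is at least the cardinality of $\mathbb{F}$.
   Context: The affine Lie algebra $\mathfrak{aff}(\mathbb{F})$ has basis $\{x,y\}$ with $[x,y]=y$. A Hom-Lie algebra is a triple $(A,[\cdot,\cdot],\sigma)$ where $A$ is an anticommutative algebra (bilinear product with $[x,x]=0$ for all $x$) and $\sigma:A\to A$ is a linear map (a twisting map) with $[\sigma(x),[y,z]]+[\sigma(y),[z,x]]+[\sigma(z),[x,y]]=0$ for all $x,y,z\in A$. A Hom-ideal is a subspace $I$ with $[I,A]\subset I$ and $\sigma(I)\subset I$; a Hom-Lie algebra is simple if it is not abelian (its product is nonzero) and its only Hom-ideals are $0$ and $A$. An isomorphism of Hom-Lie algebras $(A,[\cdot,\cdot]^A,\sigma_A)\to(B,[\cdot,\cdot]^B,\sigma_B)$ is a linear bijection $\varphi$ with $\varphi([u,v]^A)=[\varphi(u),\varphi(v)]^B$ for all $u,v$ and $\varphi\circ\sigma_A=\sigma_B\circ\varphi$. *)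

theory Defs
  imports "HOL-Analysis.Cartesian_Space" "HOL-Library.Equipollence"
begin

section \<open>Hom-Lie algebras over an arbitrary field\<close>

locale anticommutative_algebra = vector_space scale
  for scale :: "'f::field \<Rightarrow> 'a::ab_group_add \<Rightarrow> 'a" +
  fixes bracket :: "'a \<Rightarrow> 'a \<Rightarrow> 'a"
  assumes linear_bracket_left: "Vector_Spaces.linear scale scale (\<lambda>u. bracket u v)"
    and linear_bracket_right: "Vector_Spaces.linear scale scale (\<lambda>v. bracket u v)"
    and bracket_self: "bracket u u = 0"

locale hom_lie_algebra = anticommutative_algebra scale bracket
  for scale :: "'f::field \<Rightarrow> 'a::ab_group_add \<Rightarrow> 'a"
    and bracket :: "'a \<Rightarrow> 'a \<Rightarrow> 'a" +
  fixes \<sigma> :: "'a \<Rightarrow> 'a"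
  assumes linear_twist: "Vector_Spaces.linear scale scale \<sigma>"
    and hom_jacobi:
      "bracket (\<sigma> u) (bracket v w) + bracket (\<sigma> v) (bracket w u)
        + bracket (\<sigma> w) (bracket u v) = 0"
begin

definition hom_ideal :: "'a set \<Rightarrow> bool" where
  "hom_ideal I \<longleftrightarrow> subspace I \<and> (\<forall>u\<in>I. \<forall>v. bracket u v \<in> I) \<and> \<sigma> ` I \<subseteq> I"

end

locale simple_hom_lie_algebra = hom_lie_algebra +
  assumes not_abelian: "\<exists>u v. bracket u v \<noteq> 0"
    and hom_ideal_trivial: "hom_ideal I \<Longrightarrow> I = {0} \<or> I = UNIV"

definition hom_lie_isomorphism ::
  "('f::field \<Rightarrow> 'a::ab_group_add \<Rightarrow> 'a) \<Rightarrow> ('a \<Rightarrow> 'a \<Rightarrow> 'a) \<Rightarrow> ('a \<Rightarrow> 'a) \<Rightarrow>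
   ('f \<Rightarrow> 'b::ab_group_add \<Rightarrow> 'b) \<Rightarrow> ('b \<Rightarrow> 'b \<Rightarrow> 'b) \<Rightarrow> ('b \<Rightarrow> 'b) \<Rightarrow>
   ('a \<Rightarrow> 'b) \<Rightarrow> bool" where
  "hom_lie_isomorphism scaleA bracketA \<sigma>A scaleB bracketB \<sigma>B \<phi> \<longleftrightarrow>
     Vector_Spaces.linear scaleA scaleB \<phi> \<and> bij \<phi> \<and>
     (\<forall>u v. \<phi> (bracketA u v) = bracketB (\<phi> u) (\<phi> v)) \<and>
     \<phi> \<circ> \<sigma>A = \<sigma>B \<circ> \<phi>"


section \<open>The affine Lie algebra\<close>

definition aff_x :: "'f::field ^ 2" where "aff_x = axis 1 1"

definition aff_y :: "'f::field ^ 2" where "aff_y = axis 2 1"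

text \<open>The bilinear alternating extension of \<open>[x, y] = y\<close>:
  \<open>[a x + b y, c x + d y] = (a d - b c) y\<close>.\<close>

definition aff_bracket :: "'f::field ^ 2 \<Rightarrow> 'f ^ 2 \<Rightarrow> 'f ^ 2" where
  "aff_bracket u v = (u $ 1 * v $ 2 - u $ 2 * v $ 1) *s aff_y"

lemma aff_bracket_x_y: "aff_bracket aff_x aff_y = aff_y"
  by (simp add: aff_bracket_def aff_x_def aff_y_def axis_def)

lemma aff_decomp: "u = u $ 1 *s aff_x + u $ 2 *s aff_y"
  by (simp add: vec_eq_iff forall_2 aff_x_def aff_y_def axis_def)

lemma aff_basis:
  shows "(aff_x :: 'f::field ^ 2) \<noteq> aff_y"
    and "vec.independent {aff_x, aff_y :: 'f ^ 2}"
    and "vec.span {aff_x, aff_y :: 'f ^ 2} = UNIV"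
proof -
  show "(aff_x :: 'f ^ 2) \<noteq> aff_y"
    by (simp add: vec_eq_iff forall_2 aff_x_def aff_y_def axis_def)
  have "{aff_x, aff_y} = (cart_basis :: ('f ^ 2) set)"
    by (auto simp: cart_basis_def aff_x_def aff_y_def) (metis exhaust_2)
  then show "vec.independent {aff_x, aff_y :: 'f ^ 2}"
    and "vec.span {aff_x, aff_y :: 'f ^ 2} = UNIV"
    using independent_cart_basis span_cart_basis by metis+
qed

interpretation aff: anticommutative_algebra "(*s)" aff_bracket
  by unfold_locales
    (simp_all add: aff_bracket_def vec_eq_iff forall_2 aff_y_def axis_def algebra_simps)

definition aff_simple_twists :: "('f::field ^ 2 \<Rightarrow> 'f ^ 2) set" where
  "aff_simple_twists = {\<sigma>. simple_hom_lie_algebra (*s) aff_bracket \<sigma>}"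

definition aff_twist_iso :: "(('f::field ^ 2 \<Rightarrow> 'f ^ 2) \<times> ('f ^ 2 \<Rightarrow> 'f ^ 2)) set" where
  "aff_twist_iso = {(\<sigma>, \<tau>). \<sigma> \<in> aff_simple_twists \<and> \<tau> \<in> aff_simple_twists \<and>
     (\<exists>\<phi>. hom_lie_isomorphism (*s) aff_bracket \<sigma> (*s) aff_bracket \<tau> \<phi>)}"

lemma hom_lie_isomorphism_refl:
  assumes "vector_space s"
  shows "hom_lie_isomorphism s b \<sigma> s b \<sigma> id"
  using vector_space.linear_id[OF assms] by (simp add: hom_lie_isomorphism_def)

lemma hom_lie_isomorphism_inv:
  assumes "hom_lie_isomorphism s b \<sigma> s' b' \<sigma>' \<phi>"
  shows "hom_lie_isomorphism s' b' \<sigma>' s b \<sigma> (inv \<phi>)"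
proof -
  have lin: "Vector_Spaces.linear s s' \<phi>" and bij: "bij \<phi>"
    and br: "\<And>u v. \<phi> (b u v) = b' (\<phi> u) (\<phi> v)"
    and tw: "\<And>u. \<phi> (\<sigma> u) = \<sigma>' (\<phi> u)"
    using assms by (auto simp: hom_lie_isomorphism_def fun_eq_iff)
  interpret l: Vector_Spaces.linear s s' \<phi> by (fact lin)
  have [simp]: "\<phi> (inv \<phi> u) = u" "inv \<phi> (\<phi> v) = v" for u v
    using bij by (auto simp: bij_def surj_f_inv_f)
  have "Vector_Spaces.linear s' s (inv \<phi>)"
  proof (unfold_locales)
    show "inv \<phi> (u + v) = inv \<phi> u + inv \<phi> v" for u v
      using l.add[of "inv \<phi> u" "inv \<phi> v"]
      by (metis \<open>\<And>u. \<phi> (inv \<phi> u) = u\<close> \<open>\<And>v. inv \<phi> (\<phi> v) = v\<close>)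
    show "inv \<phi> (s' r u) = s r (inv \<phi> u)" for r u
      using l.scale[of r "inv \<phi> u"]
      by (metis \<open>\<And>u. \<phi> (inv \<phi> u) = u\<close> \<open>\<And>v. inv \<phi> (\<phi> v) = v\<close>)
  qed
  moreover have "inv \<phi> (b' u v) = b (inv \<phi> u) (inv \<phi> v)" for u v
    using br[of "inv \<phi> u" "inv \<phi> v"]
    by (metis \<open>\<And>u. \<phi> (inv \<phi> u) = u\<close> \<open>\<And>v. inv \<phi> (\<phi> v) = v\<close>)
  moreover have "inv \<phi> (\<sigma>' u) = \<sigma> (inv \<phi> u)" for u
    using tw[of "inv \<phi> u"]
    by (metis \<open>\<And>u. \<phi> (inv \<phi> u) = u\<close> \<open>\<And>v. inv \<phi> (\<phi> v) = v\<close>)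
  ultimately show ?thesis
    using bij by (simp add: hom_lie_isomorphism_def fun_eq_iff bij_imp_bij_inv)
qed

lemma hom_lie_isomorphism_comp:
  assumes "hom_lie_isomorphism s b \<sigma> s' b' \<sigma>' \<phi>"
    and "hom_lie_isomorphism s' b' \<sigma>' s'' b'' \<sigma>'' \<psi>"
  shows "hom_lie_isomorphism s b \<sigma> s'' b'' \<sigma>'' (\<psi> \<circ> \<phi>)"
  using assms Vector_Spaces.linear_compose[of s s' \<phi> s'' \<psi>]
  by (simp add: hom_lie_isomorphism_def fun_eq_iff bij_comp)

lemma equiv_aff_twist_iso: "equiv aff_simple_twists aff_twist_iso"
proof (rule equivI)
  show "aff_twist_iso \<subseteq> aff_simple_twists \<times> aff_simple_twists"
    by (auto simp: aff_twist_iso_def)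
  show "refl_on aff_simple_twists aff_twist_iso"
    using hom_lie_isomorphism_refl[OF vec.vector_space_axioms]
    by (auto simp: refl_on_def aff_twist_iso_def)
  show "sym aff_twist_iso"
    by (auto simp: sym_def aff_twist_iso_def intro: hom_lie_isomorphism_inv)
  show "trans aff_twist_iso"
    unfolding trans_def aff_twist_iso_def by (auto intro: hom_lie_isomorphism_comp)
qed

end

theory Submission
  imports Defs
begin

text \<open>In dimension two the Hom-Jacobi expression, being trilinear and alternating, vanishes for
  every linear \<open>\<sigma>\<close>. A nonzero ideal of the affine algebra contains \<open>y\<close>, so \<open>\<sigma>\<close> is simple as soon
  as \<open>\<sigma> y\<close> has nonzero \<open>x\<close>-coordinate. The maps \<open>\<sigma>\<^sub>c (a x + b y) = (c a + b) x\<close> satisfy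
  \<open>\<sigma>\<^sub>c \<circ> \<sigma>\<^sub>c = c \<sigma>\<^sub>c\<close> and \<open>\<sigma>\<^sub>c \<noteq> 0\<close>, so \<open>c\<close> is an isomorphism invariant.\<close>

definition aff_rank_one_twist :: "'f::field \<Rightarrow> 'f ^ 2 \<Rightarrow> 'f ^ 2" where
  "aff_rank_one_twist c u = (c * u $ 1 + u $ 2) *s aff_x"

lemma aff_coords [simp]:
  "aff_x $ 1 = 1" "aff_x $ 2 = 0" "aff_y $ 1 = 0" "aff_y $ 2 = 1"
  by (simp_all add: aff_x_def aff_y_def axis_def)

lemma hom_lie_algebra_aff:
  fixes \<sigma> :: "'f::field ^ 2 \<Rightarrow> 'f ^ 2"
  assumes "Vector_Spaces.linear (*s) (*s) \<sigma>"
  shows "hom_lie_algebra (*s) aff_bracket \<sigma>"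
proof (intro hom_lie_algebra.intro hom_lie_algebra_axioms.intro
    aff.anticommutative_algebra_axioms)
  interpret Vector_Spaces.linear "(*s)" "(*s)" \<sigma> by (fact assms)
  show "Vector_Spaces.linear (*s) (*s) \<sigma>" by (fact assms)
  \<comment> \<open>Every bracket is a multiple of \<open>aff_y\<close>, so only the first
    coordinate of its partner \<open>\<sigma> u\<close> enters the Hom-Jacobi sum.\<close>
  have coord: "\<sigma> u $ 1 = u $ 1 * \<sigma> aff_x $ 1 + u $ 2 * \<sigma> aff_y $ 1" for u
    by (subst aff_decomp[of u]) (simp only: add scale vector_add_component vector_smult_component)
  show "aff_bracket (\<sigma> u) (aff_bracket v w) + aff_bracket (\<sigma> v) (aff_bracket w u)
      + aff_bracket (\<sigma> w) (aff_bracket u v) = 0" for u v w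
    by (simp add: vec_eq_iff forall_2 aff_bracket_def coord[of u] coord[of v] coord[of w]
        algebra_simps)
qed

lemma aff_y_in_ideal:
  fixes I :: "('f::field ^ 2) set"
  assumes "vec.subspace I" and ideal: "\<And>u v. u \<in> I \<Longrightarrow> aff_bracket u v \<in> I" and "I \<noteq> {0}"
  shows "aff_y \<in> I"
proof -
  obtain u where u: "u \<in> I" "u \<noteq> 0"
    using assms(1,3) vec.subspace_0 by blast
  \<comment> \<open>Bracketing with \<open>aff_y\<close> and \<open>aff_x\<close> isolates the two
    coordinates of \<open>u\<close> as multiples of \<open>aff_y\<close>; at least one is
    nonzero.\<close>
  have "u $ 1 *s aff_y \<in> I" "- u $ 2 *s aff_y \<in> I"
    using ideal[OF u(1), of aff_y] ideal[OF u(1), of aff_x] by (simp_all add: aff_bracket_def)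
  then have "inverse (u $ 1) *s (u $ 1 *s aff_y) \<in> I" "inverse (- u $ 2) *s (- u $ 2 *s aff_y) \<in> I"
    using assms(1) vec.subspace_scale by blast+
  moreover have "u $ 1 \<noteq> 0 \<or> u $ 2 \<noteq> 0"
    using u(2) by (simp add: vec_eq_iff forall_2)
  ultimately show ?thesis
    by (auto simp: vec.scale_scale)
qed

lemma aff_simple_twist:
  fixes \<sigma> :: "'f::field ^ 2 \<Rightarrow> 'f ^ 2"
  assumes lin: "Vector_Spaces.linear (*s) (*s) \<sigma>" and nz: "\<sigma> aff_y $ 1 \<noteq> 0"
  shows "\<sigma> \<in> aff_simple_twists"
proof -
  interpret hom_lie_algebra "(*s)" aff_bracket \<sigma>
    by (rule hom_lie_algebra_aff[OF lin])
  have "simple_hom_lie_algebra (*s) aff_bracket \<sigma>"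
  proof
    show "\<exists>u v :: 'f ^ 2. aff_bracket u v \<noteq> 0"
      using aff_bracket_x_y by (metis aff_coords(4) zero_index zero_neq_one)
    show "I = {0} \<or> I = UNIV" if "hom_ideal I" for I
    proof (cases "I = {0}")
      case False
      have sub: "vec.subspace I" and ideal: "\<And>u v. u \<in> I \<Longrightarrow> aff_bracket u v \<in> I"
        and tw: "\<sigma> ` I \<subseteq> I"
        using that by (auto simp: hom_ideal_def)
      have y: "aff_y \<in> I" by (rule aff_y_in_ideal[OF sub ideal False])
      define s where "s = \<sigma> aff_y"
      have s: "s \<in> I" using y tw by (auto simp: s_def)
      have s1: "s $ 1 \<noteq> 0" using nz by (simp add: s_def)
      \<comment> \<open>Removing the \<open>aff_y\<close> part of \<open>s\<close> stays in
        \<open>I\<close> and leaves a multiple of \<open>aff_x\<close>, nonzero by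
        \<open>s1\<close>.\<close>
      have "aff_x = inverse (s $ 1) *s (s - s $ 2 *s aff_y)"
        using s1 by (simp add: vec_eq_iff forall_2)
      then have x: "aff_x \<in> I"
        by (metis s y sub vec.subspace_scale vec.subspace_diff)
      have "u \<in> I" for u
        by (subst aff_decomp[of u]) (intro vec.subspace_add vec.subspace_scale sub x y)
      then show ?thesis by blast
    qed simp
  qed
  then show ?thesis by (simp add: aff_simple_twists_def)
qed

lemma aff_rank_one_twist_simple: "aff_rank_one_twist c \<in> aff_simple_twists"
proof (rule aff_simple_twist)
  show "Vector_Spaces.linear (*s) (*s) (aff_rank_one_twist c)"
    by unfold_locales (simp_all add: aff_rank_one_twist_def vec_eq_iff forall_2 algebra_simps)
qed (simp add: aff_rank_one_twist_def)

text \<open>The image lies on the line through \<open>aff_x\<close>, which is an eigenvector with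
  eigenvalue \<open>c\<close>.\<close>

lemma aff_rank_one_twist_twice:
  "aff_rank_one_twist c (aff_rank_one_twist c u) = c *s aff_rank_one_twist c u"
  by (simp add: aff_rank_one_twist_def vec_eq_iff)

lemma aff_rank_one_twist_iso_imp_eq:
  fixes c d :: "'f::field"
  assumes "hom_lie_isomorphism (*s) aff_bracket (aff_rank_one_twist c)
    (*s) aff_bracket (aff_rank_one_twist d) \<phi>"
  shows "c = d"
proof -
  have lin: "Vector_Spaces.linear (*s) (*s) \<phi>" and "bij \<phi>"
    and tw: "\<And>u. \<phi> (aff_rank_one_twist c u) = aff_rank_one_twist d (\<phi> u)"
    using assms by (auto simp: hom_lie_isomorphism_def fun_eq_iff)
  interpret Vector_Spaces.linear "(*s)" "(*s)" \<phi> by (fact lin)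
  \<comment> \<open>The twist sends \<open>aff_y\<close> to \<open>aff_x\<close> whatever
    \<open>c\<close> is, so this vector is nonzero. Applying the twist of \<open>d\<close> to it
    gives \<open>c *s ?v\<close> by transport along \<open>\<phi>\<close>, and
    \<open>d *s ?v\<close> because it lies in the image of that twist.\<close>
  let ?v = "\<phi> (aff_rank_one_twist c aff_y)"
  have "c *s ?v = d *s ?v"
    by (metis aff_rank_one_twist_twice scale tw)
  moreover have "aff_rank_one_twist c aff_y \<noteq> 0"
    by (simp add: aff_rank_one_twist_def vec_eq_iff forall_2)
  then have "?v \<noteq> 0"
    using \<open>bij \<phi>\<close> zero by (metis bij_def inj_eq)
  ultimately show ?thesis by simp
qed

theorem theorem3p6:
  shows "(UNIV :: 'f::field set) \<lesssim>
    (aff_simple_twists :: ('f ^ 2 \<Rightarrow> 'f ^ 2) set) // aff_twist_iso"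
proof -
  let ?F = "\<lambda>c :: 'f. aff_twist_iso `` {aff_rank_one_twist c}"
  have "inj ?F"
  proof (rule injI)
    fix c d :: 'f
    assume "?F c = ?F d"
    \<comment> \<open>Equality of classes turns into an isomorphism between two members of the
      family, which forces equal parameters.\<close>
    then have "(aff_rank_one_twist c, aff_rank_one_twist d) \<in> aff_twist_iso"
      using eq_equiv_class[OF _ equiv_aff_twist_iso aff_rank_one_twist_simple] by blast
    then show "c = d"
      by (auto simp: aff_twist_iso_def intro: aff_rank_one_twist_iso_imp_eq)
  qed
  moreover have "range ?F \<subseteq> aff_simple_twists // aff_twist_iso"
    by (auto intro: quotientI aff_rank_one_twist_simple)
  ultimately show ?thesis
    unfolding lepoll_def by blast
qed

end
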